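(* Let $P_1,\dots,P_M$ be the joint distributions of (shared feature, label prediction) pairs $(f,c)$ in the $M$ domains, let $\widetilde{P}(f,c)=\frac{1}{M}\sum_{i=1}^M P_i(f,c)$, and let $$\mathcal{J}_{\mathcal{D}} = -\sum_{i=1}^M \mathbb{E}_{(f,c)\sim P_i}\big[\log \mathcal{D}_i([f,c])\big]$$ be the objective of the conditional domain discriminator $\mathcal{D}=(\mathcal{D}_1,\dots,\mathcal{D}_M)$. When $\mathcal{D}$ is trained to its optimum $\mathcal{D}^*=\arg\min_{\mathcal{D}}\mathcal{J}_{\mathcal{D}}$, $\mathcal{J}_{\mathcal{D}^*}$ is $M\log M$. The optimum can be obtained if and only if $$P_1(f,c)=P_2(f,c)=\dots=P_M(f,c)=\widetilde{P}(f,c).$$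
   Context: There are $M$ domains $D_1,\dots,D_M$ of inputs $\mathbf{x}$. A shared feature extractor $\mathcal{F}_s$ maps inputs to feature vectors of fixed length; for each domain $i$, a domain-specific feature extractor $\mathcal{F}_d^i$ maps inputs to feature vectors of fixed length; a classifier $\mathcal{C}$ maps a concatenated vector $[\mathcal{F}_s(\mathbf{x}),\mathcal{F}_d^i(\mathbf{x})]$ to a vector of label probabilities. Here $[\cdot,\cdot]$ denotes concatenation of two vectors. Write $\mathcal{C}_i=\mathcal{C}([\mathcal{F}_s(\mathbf{x}),\mathcal{F}_d^i(\mathbf{x})])$ for the prediction probability vector of the instance $\mathbf{x}$. The joint distribution of domain $i$ is $P_i(f,c) \triangleq P(f=\mathcal{F}_s(\mathbf{x}),\, c=\mathcal{C}_i \mid \mathbf{x}\in D_i)$; $P_i(f,c)$ also denotes its density. A conditional domain discriminator $\mathcal{D}=(\mathcal{D}_1,\dots,\mathcal{D}_M)$ takes $[f,c]$ as input; $\mathcal{D}_i([f,c])$ is the probability it assigns to the vector $[f,c]$ coming from the $i$-th domain, so that $\sum_{i=1}^M\mathcal{D}_i([f,c])=1$. The optimum discriminator $\mathcal{D}^*$ is taken for given $\mathcal{F}_s$, $\{\mathcal{F}_d^i\}_{i=1}^M$ and $\mathcal{C}$. In the overall model, $\mathcal{F}_s$, $\{\mathcal{F}_d^i\}_{i=1}^M$ and $\mathcal{C}$ are themselves trained, in a mini-max game against $\mathcal{D}$.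
   Formalization: For fixed extractors and classifier J_{D*} can be below M log M (disjoint P_i give 0), so it is proved that J_{D*} ≤ M log M, with equality iff all P_i agree; "the optimum" is read as the mini-max optimum over all measurable extractors and classifiers, whose value is M log M. *)

theory Defs
  imports "HOL-Probability.Probability"
begin

definition vconcat :: "real ^ 'a \<Rightarrow> real ^ 'b \<Rightarrow> real ^ ('a + 'b)"
  where "vconcat u v = (\<chi> k. case k of Inl a \<Rightarrow> u $ a | Inr b \<Rightarrow> v $ b)"

record ('x, 's, 'd, 'l) network =
  shared :: "'x \<Rightarrow> real ^ 's"
  specific :: "nat \<Rightarrow> 'x \<Rightarrow> real ^ 'd"
  classifier :: "real ^ ('s + 'd) \<Rightarrow> real ^ 'l"

text \<open>
  \<open>S\<close> carries the sigma-algebra of the input space. The components of the classifier's output are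
  label probabilities.
\<close>

definition is_network ::
    "nat \<Rightarrow> 'x measure \<Rightarrow> ('x, 's::finite, 'd::finite, 'l::finite) network \<Rightarrow> bool"
  where "is_network M S N \<longleftrightarrow>
    shared N \<in> borel_measurable S \<and>
    (\<forall>i\<in>{1..M}. specific N i \<in> borel_measurable S) \<and>
    classifier N \<in> borel_measurable borel \<and>
    (\<forall>v. (\<forall>k. 0 \<le> classifier N v $ k) \<and> (\<Sum>k\<in>UNIV. classifier N v $ k) = 1)"

definition prediction ::
    "('x, 's::finite, 'd::finite, 'l::finite) network \<Rightarrow> nat \<Rightarrow> 'x \<Rightarrow> real ^ 'l"
  where "prediction N i x = classifier N (vconcat (shared N x) (specific N i x))"

text \<open>
  The probability measure \<open>Q i\<close> is the law of an input conditioned on coming from domain \<open>i\<close>;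
  \<open>joint Q N i\<close> is then the distribution \<open>P\<^sub>i\<close> of the pair (shared feature, prediction).
\<close>

definition joint ::
    "(nat \<Rightarrow> 'x measure) \<Rightarrow> ('x, 's::finite, 'd::finite, 'l::finite) network \<Rightarrow> nat
      \<Rightarrow> ((real ^ 's) \<times> (real ^ 'l)) measure"
  where "joint Q N i = distr (Q i) borel (\<lambda>x. (shared N x, prediction N i x))"

definition mixture :: "nat \<Rightarrow> (nat \<Rightarrow> 'a::topological_space measure) \<Rightarrow> 'a measure"
  where "mixture M P =
    measure_of UNIV (sets borel) (\<lambda>A. (\<Sum>i=1..M. emeasure (P i) A) / of_nat M)"

lemma emeasure_mixture:
  assumes "M \<ge> 1" "\<And>i. i \<in> {1..M} \<Longrightarrow> sets (P i) = sets borel" "A \<in> sets borel"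
  shows "emeasure (mixture M P) A = (\<Sum>i=1..M. emeasure (P i) A) / of_nat M"
proof (rule emeasure_measure_of[OF mixture_def])
  let ?m = "\<lambda>A. (\<Sum>i=1..M. emeasure (P i) A) / of_nat M"
  show "positive (sets (mixture M P)) ?m"
    by (simp add: positive_def)
  have sets: "sets (mixture M P) = sets borel"
    unfolding mixture_def using sets.sigma_sets_eq[of borel] by (simp add: sets_measure_of)
  show "A \<in> sets (mixture M P)"
    using assms(3) sets by simp
  show "countably_additive (sets (mixture M P)) ?m"
    unfolding sets
  proof (rule countably_additiveI)
    fix B :: "nat \<Rightarrow> 'a set"
    assume B: "range B \<subseteq> sets borel" "disjoint_family B"
    have "(\<Sum>n. ?m (B n)) = (\<Sum>n. \<Sum>i=1..M. emeasure (P i) (B n)) / of_nat M"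
      by (simp add: divide_ennreal_def ennreal_suminf_multc)
    also have "(\<Sum>n. \<Sum>i=1..M. emeasure (P i) (B n)) = (\<Sum>i=1..M. \<Sum>n. emeasure (P i) (B n))"
      by (rule suminf_sum) auto
    also have "\<dots> = (\<Sum>i=1..M. emeasure (P i) (\<Union>n. B n))"
      using B assms(2) by (intro sum.cong refl suminf_emeasure) auto
    finally show "(\<Sum>n. ?m (B n)) = ?m (\<Union>n. B n)" .
  qed
qed auto

definition is_discriminator :: "nat \<Rightarrow> (nat \<Rightarrow> real ^ ('s::finite + 'l::finite) \<Rightarrow> real) \<Rightarrow> bool"
  where "is_discriminator M D \<longleftrightarrow>
    (\<forall>i\<in>{1..M}. D i \<in> borel_measurable borel \<and> (\<forall>v. 0 \<le> D i v)) \<and>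
    (\<forall>v. (\<Sum>i=1..M. D i v) = 1)"

text \<open>
  The value \<open>\<infinity>\<close> at \<open>0\<close> is given explicitly because \<open>ln 0 = 0\<close> in HOL.
\<close>

definition neg_log :: "real \<Rightarrow> ennreal"
  where "neg_log t = (if t \<le> 0 then \<infinity> else ennreal (- ln t))"

text \<open>
  A discriminator takes values in \<open>[0, 1]\<close>, so the negated logarithm is nonnegative and each
  expectation exists in \<open>[0, \<infinity>]\<close>. The minus sign of \<open>\<J>\<^sub>\<D>\<close> is taken inside the expectations.
\<close>

definition disc_objective ::
    "nat \<Rightarrow> (nat \<Rightarrow> 'x measure) \<Rightarrow> ('x, 's::finite, 'd::finite, 'l::finite) network
      \<Rightarrow> (nat \<Rightarrow> real ^ ('s + 'l) \<Rightarrow> real) \<Rightarrow> ennreal"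
  where "disc_objective M Q N D =
    (\<Sum>i=1..M. \<integral>\<^sup>+ (f, c). neg_log (D i (vconcat f c)) \<partial>joint Q N i)"

definition optimal_discriminator ::
    "nat \<Rightarrow> (nat \<Rightarrow> 'x measure) \<Rightarrow> ('x, 's::finite, 'd::finite, 'l::finite) network
      \<Rightarrow> (nat \<Rightarrow> real ^ ('s + 'l) \<Rightarrow> real) \<Rightarrow> bool"
  where "optimal_discriminator M Q N D \<longleftrightarrow>
    is_arg_min (disc_objective M Q N) (is_discriminator M) D"

text \<open>
  The extractors and the classifier play against the discriminator: they maximise over all networks
  the value left after the discriminator has minimised.
\<close>

definition minimax_optimum ::
    "nat \<Rightarrow> 'x measure \<Rightarrow> (nat \<Rightarrow> 'x measure)
      \<Rightarrow> ('x, 's::finite, 'd::finite, 'l::finite) network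
      \<Rightarrow> (nat \<Rightarrow> real ^ ('s + 'l) \<Rightarrow> real) \<Rightarrow> bool"
  where "minimax_optimum M S Q N D \<longleftrightarrow>
    is_arg_max (\<lambda>N'. INF D'\<in>Collect (is_discriminator M). disc_objective M Q N' D')
      (is_network M S) N \<and>
    optimal_discriminator M Q N D"

end

theory Submission imports Defs begin

text \<open>
  Relative to the mixture \<open>\<mu>\<close>, each \<open>P\<^sub>i\<close> has density \<open>M p\<^sub>i\<close>, where \<open>(p\<^sub>1, \<dots>, p\<^sub>M)\<close> is a
  probability vector at every point. The objective of a discriminator is therefore \<open>M\<close> times the
  \<open>\<mu>\<close>-integral of the cross entropy of \<open>p\<close> and \<open>\<D>\<close>. By Gibbs' inequality it is minimised pointwise by
  \<open>\<D> = p\<close>, and the minimum is \<open>M\<close> times the mean entropy of \<open>p\<close>. Entropy is at most \<open>ln M\<close>, with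
  equality only at the uniform vector, i.e. when \<open>P\<^sub>i = \<mu>\<close> for all \<open>i\<close>. A constant network attains
  this bound, so the networks maximising the minimum are exactly those with value \<open>M ln M\<close>.
\<close>

section \<open>Gibbs' inequality and the entropy of finite probability vectors\<close>

text \<open>The bound ln t \<le> t - 1 at t = d / p, multiplied by p. At p = 0 both products vanish
  and -d \<le> 0 remains. Summed over two probability vectors the left side cancels, which is how
  Gibbs' inequality arises.\<close>

lemma mult_ln_diff_ge:
  fixes p d :: real
  assumes "0 \<le> p" "0 \<le> d" "p > 0 \<Longrightarrow> d > 0"
  shows "p - d \<le> p * ln p - p * ln d"
proof (cases "p = 0")
  case False
  with assms have pos: "p > 0" "d > 0" by auto
  then have "ln d - ln p \<le> d / p - 1"
    using ln_le_minus_one[of "d / p"] by (simp add: ln_div)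
  then have "p * (ln d - ln p) \<le> p * (d / p - 1)"
    using pos by (intro mult_left_mono) auto
  with pos show ?thesis by (simp add: algebra_simps)
qed (use assms in simp)

text \<open>Equality in ln t \<le> t - 1 holds only at t = 1.\<close>

lemma mult_ln_diff_eqD:
  fixes p d :: real
  assumes "0 \<le> p" "0 < d" "p - d = p * ln p - p * ln d"
  shows "p = d"
proof (cases "p = 0")
  case False
  with assms have pos: "p > 0" by auto
  have "p * (ln d - ln p) = p * (d / p - 1)"
    using pos assms(3) by (simp add: algebra_simps)
  with pos have "ln (d / p) = d / p - 1"
    using assms(2) by (simp add: ln_div)
  with pos have "d / p = 1"
    using assms(2) by (intro ln_eq_minus_one) auto
  with pos show ?thesis by simp
qed (use assms in simp)

lemma measurable_neg_log[measurable]: "neg_log \<in> borel_measurable borel"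
  unfolding neg_log_def by measurable

lemma mult_neg_log:
  assumes "0 \<le> p" "d \<le> 1" "p > 0 \<Longrightarrow> d > 0"
  shows "ennreal p * neg_log d = ennreal (- (p * ln d))"
proof (cases "p = 0")
  case False
  with assms have "d > 0" "ln d \<le> 0" by auto
  with assms show ?thesis
    by (simp add: neg_log_def ennreal_mult[symmetric])
qed (use assms in simp)

lemma prob_vector_le_1:
  fixes p :: "'i \<Rightarrow> real"
  assumes "finite I" "\<And>i. i \<in> I \<Longrightarrow> 0 \<le> p i" "(\<Sum>i\<in>I. p i) = 1" "i \<in> I"
  shows "p i \<le> 1"
  using member_le_sum[of i I p] assms by auto

text \<open>With values in \<open>ennreal\<close>, a zero of d costs infinity where p is positive
  and nothing where p vanishes, because 0 times infinity is 0.\<close>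

definition cross_entropy :: "'i set \<Rightarrow> ('i \<Rightarrow> real) \<Rightarrow> ('i \<Rightarrow> real) \<Rightarrow> ennreal"
  where "cross_entropy I p d = (\<Sum>i\<in>I. ennreal (p i) * neg_log (d i))"

text \<open>The assumption \<open>pos\<close> excludes infinite terms, and d \<le> 1 makes every
  remaining term nonnegative, so the sum can be taken in the reals.\<close>

lemma cross_entropy_eq:
  assumes "finite I"
    and p: "\<And>i. i \<in> I \<Longrightarrow> 0 \<le> p i"
    and d: "\<And>i. i \<in> I \<Longrightarrow> 0 \<le> d i" "(\<Sum>i\<in>I. d i) = 1"
    and pos: "\<And>i. i \<in> I \<Longrightarrow> p i > 0 \<Longrightarrow> d i > 0"
  shows "cross_entropy I p d = ennreal (\<Sum>i\<in>I. - (p i * ln (d i)))"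
proof -
  have d1: "d i \<le> 1" if "i \<in> I" for i
    using prob_vector_le_1[of I d] assms(1) d that by auto
  have nonneg: "0 \<le> - (p i * ln (d i))" if "i \<in> I" for i
  proof (cases "p i = 0")
    case False
    with that p have "p i > 0" by (simp add: order_less_le)
    with that pos d1 have "ln (d i) \<le> 0" by simp
    with that p show ?thesis by (simp add: mult_nonneg_nonpos)
  qed simp
  have "cross_entropy I p d = (\<Sum>i\<in>I. ennreal (- (p i * ln (d i))))"
    unfolding cross_entropy_def
    by (intro sum.cong refl mult_neg_log) (auto simp: p d1 pos)
  also have "\<dots> = ennreal (\<Sum>i\<in>I. - (p i * ln (d i)))"
    using nonneg by (rule sum_ennreal)
  finally show ?thesis .
qed

text \<open>If d vanishes somewhere p does not, the right side is infinite. Otherwise both sides are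
  real, and \<open>mult_ln_diff_ge\<close> is summed; the differences p - d add up to 0.\<close>

lemma gibbs:
  assumes "finite I"
    and p: "\<And>i. i \<in> I \<Longrightarrow> 0 \<le> p i" "(\<Sum>i\<in>I. p i) = 1"
    and d: "\<And>i. i \<in> I \<Longrightarrow> 0 \<le> d i" "(\<Sum>i\<in>I. d i) = 1"
  shows "cross_entropy I p p \<le> cross_entropy I p d"
proof (cases "\<exists>i\<in>I. p i > 0 \<and> d i \<le> 0")
  case True
  then obtain i where i: "i \<in> I" "p i > 0" "d i \<le> 0" by auto
  then have "ennreal (p i) * neg_log (d i) = \<infinity>"
    by (simp add: neg_log_def ennreal_mult_top)
  moreover have "ennreal (p i) * neg_log (d i) \<le> cross_entropy I p d"
    unfolding cross_entropy_def using i assms(1)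
    by (intro member_le_sum) auto
  ultimately show ?thesis by (simp add: top_unique)
next
  case False
  then have pos: "d i > 0" if "i \<in> I" "p i > 0" for i
    using that by force
  have "0 = (\<Sum>i\<in>I. p i - d i)"
    using p d by (simp add: sum_subtractf)
  also have "\<dots> \<le> (\<Sum>i\<in>I. p i * ln (p i) - p i * ln (d i))"
    by (intro sum_mono mult_ln_diff_ge) (auto simp: p d pos)
  finally have "(\<Sum>i\<in>I. - (p i * ln (p i))) \<le> (\<Sum>i\<in>I. - (p i * ln (d i)))"
    by (simp add: sum_subtractf sum_negf)
  then show ?thesis
    using assms pos by (simp add: cross_entropy_eq ennreal_leI)
qed

text \<open>Every term carries the same factor ln (card I) and the weights sum to 1, so the value
  does not depend on p. This makes the uniform vector the right comparison in Gibbs'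
  inequality.\<close>

lemma entropy_uniform:
  assumes "finite I" "I \<noteq> {}"
    and p: "\<And>i. i \<in> I \<Longrightarrow> 0 \<le> p i" "(\<Sum>i\<in>I. p i) = 1"
  shows "cross_entropy I p (\<lambda>_. 1 / card I) = ennreal (ln (card I))"
proof -
  have "card I > 0" using assms by (simp add: card_gt_0_iff)
  then have "cross_entropy I p (\<lambda>_. 1 / card I) = ennreal (\<Sum>i\<in>I. - (p i * ln (1 / card I)))"
    using assms by (intro cross_entropy_eq) auto
  also have "(\<Sum>i\<in>I. - (p i * ln (1 / card I))) = ln (card I)"
    using p(2) \<open>card I > 0\<close> by (simp add: ln_div sum_distrib_right[symmetric])
  finally show ?thesis .
qed

lemma entropy_le_ln_card:
  assumes "finite I" "I \<noteq> {}"
    and p: "\<And>i. i \<in> I \<Longrightarrow> 0 \<le> p i" "(\<Sum>i\<in>I. p i) = 1"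
  shows "cross_entropy I p p \<le> ennreal (ln (card I))"
proof -
  have "cross_entropy I p p \<le> cross_entropy I p (\<lambda>_. 1 / card I)"
    using assms by (intro gibbs) auto
  with entropy_uniform[of I p] assms show ?thesis by simp
qed

text \<open>This is the equality case of Gibbs' inequality against the uniform vector: nonnegative
  defects with sum 0 vanish one by one.\<close>

lemma entropy_eq_ln_cardD:
  assumes "finite I" "I \<noteq> {}"
    and p: "\<And>i. i \<in> I \<Longrightarrow> 0 \<le> p i" "(\<Sum>i\<in>I. p i) = 1"
    and eq: "cross_entropy I p p = ennreal (ln (card I))"
    and "i \<in> I"
  shows "p i = 1 / card I"
proof -
  define d :: real where "d = 1 / card I"
  have card: "card I > 0" using assms by (simp add: card_gt_0_iff)
  then have d: "d > 0" by (simp add: d_def)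
  have "p j \<le> 1" if "j \<in> I" for j
    using prob_vector_le_1[of I p] assms(1) p that by auto
  then have "0 \<le> - (p j * ln (p j))" if "j \<in> I" for j
    using that p(1)[of j] by (cases "p j = 0") (auto intro!: mult_nonneg_nonpos)
  then have "0 \<le> (\<Sum>j\<in>I. - (p j * ln (p j)))"
    by (rule sum_nonneg)
  moreover have "ennreal (\<Sum>j\<in>I. - (p j * ln (p j))) = ennreal (ln (card I))"
    using eq p assms(1) by (simp add: cross_entropy_eq)
  \<comment> \<open>\<open>ennreal\<close> sends all negative reals to 0, so it can be cancelled
    only because both sides are known to be nonnegative.\<close>
  ultimately have "(\<Sum>j\<in>I. - (p j * ln (p j))) = ln (card I)"
    using card by (subst (asm) ennreal_inj) auto
  moreover have "(\<Sum>j\<in>I. p j * ln d) = - ln (card I)"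
    unfolding sum_distrib_right[symmetric] using card p(2) by (simp add: d_def ln_div)
  moreover have "(\<Sum>j\<in>I. d) = 1"
    using card by (simp add: d_def)
  ultimately have sum0: "(\<Sum>j\<in>I. (p j * ln (p j) - p j * ln d) - (p j - d)) = 0"
    using p(2) by (simp add: sum_subtractf sum_negf)
  have "\<forall>j\<in>I. (p j * ln (p j) - p j * ln d) - (p j - d) = 0"
  proof (subst sum_nonneg_eq_0_iff[symmetric])
    show "0 \<le> (p j * ln (p j) - p j * ln d) - (p j - d)" if "j \<in> I" for j
      using mult_ln_diff_ge[of "p j" d] that p d by simp
  qed (use assms(1) sum0 in auto)
  with \<open>i \<in> I\<close> have "p i - d = p i * ln (p i) - p i * ln d" by simp
  with p(1)[OF \<open>i \<in> I\<close>] d have "p i = d"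
    by (rule mult_ln_diff_eqD)
  then show ?thesis by (simp add: d_def)
qed

section \<open>The mixture and the densities relative to it\<close>

lemma sets_mixture[simp, measurable_cong]: "sets (mixture M P) = sets borel"
  unfolding mixture_def using sets.sigma_sets_eq[of borel] by (simp add: sets_measure_of)

lemma space_mixture[simp]: "space (mixture M P) = UNIV"
  using sets_eq_imp_space_eq[OF sets_mixture] by simp

lemma prob_space_mixture:
  assumes "M \<ge> 1" "\<And>i. i \<in> {1..M} \<Longrightarrow> sets (P i) = sets borel"
    and "\<And>i. i \<in> {1..M} \<Longrightarrow> prob_space (P i)"
  shows "prob_space (mixture M P)"
proof
  have "emeasure (P i) UNIV = 1" if "i \<in> {1..M}" for i
    using prob_space.emeasure_space_1[of "P i"] assms that
      sets_eq_imp_space_eq[of "P i" borel] by simp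
  then have "emeasure (mixture M P) UNIV = of_nat M / of_nat M"
    using assms(1,2) by (subst emeasure_mixture) auto
  then show "emeasure (mixture M P) (space (mixture M P)) = 1"
    using assms(1) by (simp add: ennreal_divide_self ennreal_of_nat_eq_real_of_nat)
qed

text \<open>Here \<open>p i z\<close> is the posterior probability of domain i given z. A null set
  of the mixture is null for each \<open>P i\<close>, so Radon-Nikodym densities exist; divided by M
  they sum to 1 almost everywhere. They are adjusted to do so everywhere, since a discriminator must
  be normalised at every point.\<close>

lemma mixture_densities:
  fixes P :: "nat \<Rightarrow> 'a::topological_space measure"
  assumes M: "M \<ge> 1" and sets_P: "\<And>i. i \<in> {1..M} \<Longrightarrow> sets (P i) = sets borel"
    and prob_P: "\<And>i. i \<in> {1..M} \<Longrightarrow> prob_space (P i)"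
  obtains p :: "nat \<Rightarrow> 'a \<Rightarrow> real" where
    "\<And>i. i \<in> {1..M} \<Longrightarrow> p i \<in> borel_measurable borel"
    "\<And>i z. i \<in> {1..M} \<Longrightarrow> 0 \<le> p i z"
    "\<And>z. (\<Sum>i=1..M. p i z) = 1"
    "\<And>i. i \<in> {1..M} \<Longrightarrow> P i = density (mixture M P) (\<lambda>z. of_nat M * ennreal (p i z))"
proof -
  let ?\<mu> = "mixture M P"
  interpret \<mu>: prob_space ?\<mu>
    using assms by (rule prob_space_mixture)
  have emeasure: "emeasure ?\<mu> A = (\<Sum>i=1..M. emeasure (P i) A) / of_nat M"
    if "A \<in> sets borel" for A
    using M sets_P that by (rule emeasure_mixture)
  have "\<exists>f \<in> borel_measurable ?\<mu>. density ?\<mu> f = P i" if i: "i \<in> {1..M}" for i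
  proof (rule \<mu>.Radon_Nikodym)
    show "absolutely_continuous ?\<mu> (P i)"
      unfolding absolutely_continuous_def
    proof
      fix A assume A: "A \<in> null_sets ?\<mu>"
      then have "A \<in> sets borel" by auto
      have "(\<Sum>i=1..M. emeasure (P i) A) / of_nat M = 0"
        using A emeasure[OF \<open>A \<in> sets borel\<close>] by auto
      then have "(\<Sum>i=1..M. emeasure (P i) A) = 0"
        by (simp add: ennreal_of_nat_eq_real_of_nat)
      with i \<open>A \<in> sets borel\<close> sets_P show "A \<in> null_sets (P i)"
        by (auto simp: null_sets_def)
    qed
    show "sets (P i) = sets ?\<mu>" using sets_P i by simp
  qed
  then obtain f where f: "\<And>i. i \<in> {1..M} \<Longrightarrow> f i \<in> borel_measurable borel"
    "\<And>i. i \<in> {1..M} \<Longrightarrow> density ?\<mu> (f i) = P i"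
    by (metis measurable_cong_sets sets_mixture)
  have [measurable]: "(\<lambda>z. \<Sum>i=1..M. f i z) \<in> borel_measurable borel"
    using f(1) by (intro borel_measurable_sum) auto
  \<comment> \<open>Both sides are the sum of all \<open>P i\<close>, which is M times the
    mixture.\<close>
  have eq: "density ?\<mu> (\<lambda>z. \<Sum>i=1..M. f i z) = density ?\<mu> (\<lambda>_. of_nat M)"
  proof (rule measure_eqI)
    fix A assume "A \<in> sets (density ?\<mu> (\<lambda>z. \<Sum>i=1..M. f i z))"
    then have A[measurable]: "A \<in> sets borel" by simp
    have "emeasure (density ?\<mu> (\<lambda>z. \<Sum>i=1..M. f i z)) A
        = (\<integral>\<^sup>+z. (\<Sum>i=1..M. f i z) * indicator A z \<partial>?\<mu>)"
      by (intro emeasure_density) measurable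
    also have "\<dots> = (\<integral>\<^sup>+z. (\<Sum>i=1..M. f i z * indicator A z) \<partial>?\<mu>)"
      by (simp only: sum_distrib_right)
    also have "\<dots> = (\<Sum>i=1..M. \<integral>\<^sup>+z. f i z * indicator A z \<partial>?\<mu>)"
      using f(1) by (intro nn_integral_sum) auto
    also have "\<dots> = (\<Sum>i=1..M. emeasure (P i) A)"
      using f by (intro sum.cong refl) (simp add: emeasure_density flip: f(2))
    also have "\<dots> = of_nat M * emeasure ?\<mu> A"
      using M unfolding emeasure[OF A] ennreal_times_divide
      by (subst mult.commute) (simp add: mult_divide_eq_ennreal)
    also have "\<dots> = emeasure (density ?\<mu> (\<lambda>_. of_nat M)) A"
      by (simp add: emeasure_density nn_integral_cmult_indicator)
    finally show "emeasure (density ?\<mu> (\<lambda>z. \<Sum>i=1..M. f i z)) A = \<dots>" .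
  qed simp
  have AE: "AE z in ?\<mu>. (\<Sum>i=1..M. f i z) = of_nat M"
    by (rule \<mu>.density_unique_iff[THEN iffD1, OF _ _ eq]) measurable
  \<comment> \<open>On the exceptional null set the uniform vector is substituted.\<close>
  define p where "p i z = (if (\<Sum>j=1..M. f j z) = of_nat M then enn2real (f i z) / real M
    else 1 / real M)" for i z
  \<comment> \<open>\<open>enn2real\<close> maps infinity to 0, so finiteness is what keeps the
    conversion to reals faithful.\<close>
  have fin: "f i z < \<infinity>" if "i \<in> {1..M}" "(\<Sum>j=1..M. f j z) = of_nat M" for i z
  proof -
    have "f i z \<le> (\<Sum>j=1..M. f j z)"
      using that(1) by (intro member_le_sum) auto
    also have "\<dots> < \<infinity>" using that(2) by (simp add: ennreal_of_nat_eq_real_of_nat)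
    finally show ?thesis .
  qed
  show thesis
  proof
    show "p i \<in> borel_measurable borel" if "i \<in> {1..M}" for i
      using f(1)[OF that] unfolding p_def by measurable
    show "0 \<le> p i z" for i z by (simp add: p_def)
    show "(\<Sum>i=1..M. p i z) = 1" for z
    proof (cases "(\<Sum>j=1..M. f j z) = of_nat M")
      case True
      have "(\<Sum>i=1..M. enn2real (f i z)) = enn2real (\<Sum>i=1..M. f i z)"
        using fin[OF _ True] by (subst enn2real_sum) auto
      with True M show ?thesis
        by (simp add: p_def sum_divide_distrib[symmetric])
    next
      case False
      with M show ?thesis by (simp add: p_def)
    qed
    show "P i = density ?\<mu> (\<lambda>z. of_nat M * ennreal (p i z))" if i: "i \<in> {1..M}" for i
    proof -
      have "AE z in ?\<mu>. f i z = of_nat M * ennreal (p i z)"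
        using AE
      proof eventually_elim
        case (elim z)
        with fin[OF i elim] M show ?case
          by (simp add: p_def ennreal_of_nat_eq_real_of_nat ennreal_mult[symmetric])
      qed
      moreover have "p i \<in> borel_measurable borel"
        using f(1)[OF i] unfolding p_def by measurable
      ultimately have "density ?\<mu> (f i) = density ?\<mu> (\<lambda>z. of_nat M * ennreal (p i z))"
        using f(1)[OF i] by (intro density_cong) auto
      with f(2)[OF i] show ?thesis by simp
    qed
  qed
qed

section \<open>Minimising the objective over functions of the pair\<close>

text \<open>The objective for arbitrary measures, with d a function on their underlying space, so
  that concatenation of vectors plays no part yet.\<close>

definition sum_neg_log ::
    "nat \<Rightarrow> (nat \<Rightarrow> 'a measure) \<Rightarrow> (nat \<Rightarrow> 'a \<Rightarrow> real) \<Rightarrow> ennreal"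
  where "sum_neg_log M P d = (\<Sum>i=1..M. \<integral>\<^sup>+z. neg_log (d i z) \<partial>P i)"

text \<open>Writing all M integrals against the one measure \<open>mixture M P\<close> merges them
  into a single integral, which can then be minimised pointwise.\<close>

lemma sum_neg_log_eq:
  fixes P :: "nat \<Rightarrow> 'a::topological_space measure"
  assumes p: "\<And>i. i \<in> {1..M} \<Longrightarrow> p i \<in> borel_measurable borel"
    and P: "\<And>i. i \<in> {1..M} \<Longrightarrow> P i = density (mixture M P) (\<lambda>z. of_nat M * ennreal (p i z))"
    and d: "\<And>i. i \<in> {1..M} \<Longrightarrow> d i \<in> borel_measurable borel"
  shows "sum_neg_log M P d =
    (\<integral>\<^sup>+z. of_nat M * cross_entropy {1..M} (\<lambda>i. p i z) (\<lambda>i. d i z) \<partial>mixture M P)"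
proof -
  let ?\<mu> = "mixture M P"
  have "(\<integral>\<^sup>+z. neg_log (d i z) \<partial>P i)
      = (\<integral>\<^sup>+z. of_nat M * ennreal (p i z) * neg_log (d i z) \<partial>?\<mu>)" if i: "i \<in> {1..M}" for i
  proof -
    note [measurable] = p[OF i] d[OF i]
    show ?thesis by (subst P[OF i], rule nn_integral_density) measurable
  qed
  then have "sum_neg_log M P d
      = (\<Sum>i=1..M. \<integral>\<^sup>+z. of_nat M * ennreal (p i z) * neg_log (d i z) \<partial>?\<mu>)"
    by (simp add: sum_neg_log_def)
  also have "\<dots> = (\<integral>\<^sup>+z. (\<Sum>i=1..M. of_nat M * ennreal (p i z) * neg_log (d i z)) \<partial>?\<mu>)"
  proof (rule nn_integral_sum[symmetric])
    fix i assume i: "i \<in> {1..M}"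
    note [measurable] = p[OF i] d[OF i]
    show "(\<lambda>z. of_nat M * ennreal (p i z) * neg_log (d i z)) \<in> borel_measurable ?\<mu>"
      by measurable
  qed
  finally show ?thesis
    by (simp add: cross_entropy_def sum_distrib_left mult.assoc)
qed

text \<open>The nonnegative function c - h has integral 0, hence vanishes almost everywhere;
  finiteness of c makes the subtraction legitimate in \<open>ennreal\<close>.\<close>

lemma (in prob_space) nn_integral_eq_bound_imp_AE:
  assumes h: "h \<in> borel_measurable M" "\<And>z. h z \<le> c" and c: "c < \<infinity>"
    and eq: "(\<integral>\<^sup>+z. h z \<partial>M) = c"
  shows "AE z in M. h z = c"
proof -
  have "(\<integral>\<^sup>+z. c - h z \<partial>M) = (\<integral>\<^sup>+z. c \<partial>M) - (\<integral>\<^sup>+z. h z \<partial>M)"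
    using h c eq by (intro nn_integral_diff) auto
  also have "\<dots> = 0"
    using eq c by (simp add: emeasure_space_1)
  finally have "AE z in M. c - h z = 0"
    using h by (subst (asm) nn_integral_0_iff_AE) auto
  then show ?thesis
  proof eventually_elim
    case (elim z)
    then have "c \<le> h z"
      using c by (simp add: diff_eq_0_iff_ennreal)
    with h(2) show ?case by (rule antisym)
  qed
qed

text \<open>The minimiser is the posterior vector from \<open>mixture_densities\<close>. Its value
  is M times the mean of its entropy, so the bound and the equality case for entropy carry over to
  the integral.\<close>

lemma sum_neg_log_minimum:
  fixes P :: "nat \<Rightarrow> 'a::topological_space measure"
  assumes M: "M \<ge> 1" and sets_P: "\<And>i. i \<in> {1..M} \<Longrightarrow> sets (P i) = sets borel"
    and prob_P: "\<And>i. i \<in> {1..M} \<Longrightarrow> prob_space (P i)"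
  obtains p :: "nat \<Rightarrow> 'a \<Rightarrow> real" where
    "\<And>i. i \<in> {1..M} \<Longrightarrow> p i \<in> borel_measurable borel"
    "\<And>i z. i \<in> {1..M} \<Longrightarrow> 0 \<le> p i z"
    "\<And>z. (\<Sum>i=1..M. p i z) = 1"
    "\<And>d. (\<And>i. i \<in> {1..M} \<Longrightarrow> d i \<in> borel_measurable borel) \<Longrightarrow>
      (\<And>i z. i \<in> {1..M} \<Longrightarrow> 0 \<le> d i z) \<Longrightarrow> (\<And>z. (\<Sum>i=1..M. d i z) = 1) \<Longrightarrow>
      sum_neg_log M P p \<le> sum_neg_log M P d"
    "sum_neg_log M P p \<le> ennreal (real M * ln (real M))"
    "sum_neg_log M P p = ennreal (real M * ln (real M)) \<longleftrightarrow> (\<forall>i\<in>{1..M}. P i = mixture M P)"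
proof -
  let ?\<mu> = "mixture M P"
  let ?c = "ennreal (real M * ln (real M))"
  obtain p :: "nat \<Rightarrow> 'a \<Rightarrow> real" where
    p: "\<And>i. i \<in> {1..M} \<Longrightarrow> p i \<in> borel_measurable borel"
      "\<And>i z. i \<in> {1..M} \<Longrightarrow> 0 \<le> p i z" "\<And>z. (\<Sum>i=1..M. p i z) = 1"
    and P: "\<And>i. i \<in> {1..M} \<Longrightarrow> P i = density ?\<mu> (\<lambda>z. of_nat M * ennreal (p i z))"
    using mixture_densities[of M P, OF assms] by blast
  interpret \<mu>: prob_space ?\<mu>
    using assms by (rule prob_space_mixture)
  define h where "h z = of_nat M * cross_entropy {1..M} (\<lambda>i. p i z) (\<lambda>i. p i z)" for z
  have [measurable]: "h \<in> borel_measurable borel"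
  proof -
    have "(\<lambda>z. ennreal (p i z) * neg_log (p i z)) \<in> borel_measurable borel" if "i \<in> {1..M}" for i
      using p(1)[OF that] by measurable
    then have "(\<lambda>z. \<Sum>i=1..M. ennreal (p i z) * neg_log (p i z)) \<in> borel_measurable borel"
      by (rule borel_measurable_sum)
    then show ?thesis
      unfolding h_def cross_entropy_def by (intro borel_measurable_times_ennreal) auto
  qed
  have val: "sum_neg_log M P p = (\<integral>\<^sup>+z. h z \<partial>?\<mu>)"
    unfolding h_def using p(1) P p(1) by (rule sum_neg_log_eq)
  have c: "?c = of_nat M * ennreal (ln (real M))"
    using M by (simp add: ennreal_mult ennreal_of_nat_eq_real_of_nat)
  have h_le: "h z \<le> ?c" for z
    using entropy_le_ln_card[of "{1..M}" "\<lambda>i. p i z"] p M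
    unfolding h_def c by (intro mult_left_mono) auto
  show thesis
  proof
    fix d :: "nat \<Rightarrow> 'a \<Rightarrow> real"
    assume d: "\<And>i. i \<in> {1..M} \<Longrightarrow> d i \<in> borel_measurable borel"
      "\<And>i z. i \<in> {1..M} \<Longrightarrow> 0 \<le> d i z" "\<And>z. (\<Sum>i=1..M. d i z) = 1"
    have "(\<integral>\<^sup>+z. h z \<partial>?\<mu>)
        \<le> (\<integral>\<^sup>+z. of_nat M * cross_entropy {1..M} (\<lambda>i. p i z) (\<lambda>i. d i z) \<partial>?\<mu>)"
      unfolding h_def using p d by (intro nn_integral_mono mult_left_mono gibbs) auto
    also have "\<dots> = sum_neg_log M P d"
      using p(1) P d(1) by (rule sum_neg_log_eq[symmetric])
    finally show "sum_neg_log M P p \<le> sum_neg_log M P d"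
      by (simp add: val)
  next
    have "(\<integral>\<^sup>+z. h z \<partial>?\<mu>) \<le> (\<integral>\<^sup>+z. ?c \<partial>?\<mu>)"
      using h_le by (intro nn_integral_mono)
    then show "sum_neg_log M P p \<le> ?c"
      using \<mu>.emeasure_space_1 by (simp add: val)
  next
    show "sum_neg_log M P p = ?c \<longleftrightarrow> (\<forall>i\<in>{1..M}. P i = ?\<mu>)"
    proof
      \<comment> \<open>The mean reaches the pointwise bound, so the entropy is maximal almost
        everywhere. The posterior is then uniform there and each density M p is 1.\<close>
      assume "sum_neg_log M P p = ?c"
      then have AE: "AE z in ?\<mu>. h z = ?c"
        using h_le val by (intro \<mu>.nn_integral_eq_bound_imp_AE) auto
      show "\<forall>i\<in>{1..M}. P i = ?\<mu>"
      proof
        fix i assume i: "i \<in> {1..M}"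
        note [measurable] = p(1)[OF i]
        from AE have "AE z in ?\<mu>. of_nat M * ennreal (p i z) = 1"
        proof eventually_elim
          case (elim z)
          then have "cross_entropy {1..M} (\<lambda>i. p i z) (\<lambda>i. p i z) = ennreal (ln (card {1..M}))"
            using M unfolding h_def c by (simp add: ennreal_mult_cancel_left)
          then have "p i z = 1 / card {1..M}"
            using p i M by (intro entropy_eq_ln_cardD[where I = "{1..M}"]) auto
          then show ?case
            using M by (simp add: ennreal_of_nat_eq_real_of_nat ennreal_mult[symmetric])
        qed
        then have "density ?\<mu> (\<lambda>z. of_nat M * ennreal (p i z)) = density ?\<mu> (\<lambda>_. 1)"
          by (intro density_cong) auto
        with P[OF i] show "P i = ?\<mu>" by (simp add: density_1)
      qed
    next
      \<comment> \<open>Conversely, uniqueness of densities gives M p = 1 almost everywhere, and the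
        uniform vector has entropy ln M.\<close>
      assume eq: "\<forall>i\<in>{1..M}. P i = ?\<mu>"
      have "AE z in ?\<mu>. p i z = 1 / real M" if i: "i \<in> {1..M}" for i
      proof -
        note [measurable] = p(1)[OF i]
        have "density ?\<mu> (\<lambda>z. of_nat M * ennreal (p i z)) = density ?\<mu> (\<lambda>_. 1)"
          using P[OF i] eq i by (simp add: density_1)
        then have "AE z in ?\<mu>. of_nat M * ennreal (p i z) = 1"
          by (subst (asm) \<mu>.density_unique_iff) auto
        then show ?thesis
        proof eventually_elim
          case (elim z)
          with p(2)[OF i, of z] have "ennreal (real M * p i z) = ennreal 1"
            by (simp add: ennreal_mult ennreal_of_nat_eq_real_of_nat)
          with p(2)[OF i, of z] have "real M * p i z = 1"
            by (subst (asm) ennreal_inj) auto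
          with M show ?case by (simp add: field_simps)
        qed
      qed
      then have "AE z in ?\<mu>. \<forall>i\<in>{1..M}. p i z = 1 / real M"
        by (intro AE_finite_allI) auto
      then have "AE z in ?\<mu>. h z = ?c"
      proof eventually_elim
        case (elim z)
        then have "cross_entropy {1..M} (\<lambda>i. p i z) (\<lambda>i. p i z)
            = cross_entropy {1..M} (\<lambda>i. p i z) (\<lambda>_. 1 / card {1..M})"
          unfolding cross_entropy_def by (intro sum.cong) auto
        also have "\<dots> = ennreal (ln (card {1..M}))"
          using p M by (intro entropy_uniform) auto
        finally show ?case by (simp add: h_def c)
      qed
      then have "(\<integral>\<^sup>+z. h z \<partial>?\<mu>) = (\<integral>\<^sup>+z. ?c \<partial>?\<mu>)"
        by (rule nn_integral_cong_AE)
      then show "sum_neg_log M P p = ?c"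
        using \<mu>.emeasure_space_1 by (simp add: val)
    qed
  qed (use p in auto)
qed

section \<open>Discriminators on concatenated vectors\<close>

lemma continuous_vconcat:
  "continuous_on UNIV (\<lambda>z :: (real ^ 's::finite) \<times> (real ^ 'l::finite). vconcat (fst z) (snd z))"
  unfolding vconcat_def
proof (rule continuous_on_vec_lambda)
  fix k :: "'s + 'l"
  show "continuous_on UNIV (\<lambda>z :: (real ^ 's) \<times> (real ^ 'l).
      case k of Inl a \<Rightarrow> fst z $ a | Inr b \<Rightarrow> snd z $ b)"
    by (cases k) (auto intro!: continuous_intros)
qed

lemma measurable_vconcat[measurable]:
  fixes f :: "'x \<Rightarrow> real ^ 's::finite" and g :: "'x \<Rightarrow> real ^ 'l::finite"
  assumes "f \<in> borel_measurable A" "g \<in> borel_measurable A"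
  shows "(\<lambda>x. vconcat (f x) (g x)) \<in> borel_measurable A"
  using measurable_compose[OF borel_measurable_Pair[OF assms]
      borel_measurable_continuous_onI[OF continuous_vconcat]] by simp

text \<open>A measurable left inverse of concatenation, by which a function of the pair becomes a
  function of the concatenated vector.\<close>

definition vsplit :: "real ^ ('s::finite + 'l::finite) \<Rightarrow> (real ^ 's) \<times> (real ^ 'l)"
  where "vsplit v = ((\<chi> a. v $ Inl a), (\<chi> b. v $ Inr b))"

lemma vsplit_vconcat[simp]: "vsplit (vconcat f c) = (f, c)"
  by (simp add: vsplit_def vconcat_def vec_eq_iff)

lemma measurable_vsplit[measurable]: "vsplit \<in> borel_measurable borel"
  unfolding vsplit_def
  by (intro borel_measurable_continuous_onI continuous_intros)

lemma disc_objective_eq: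
  "disc_objective M Q N D = sum_neg_log M (joint Q N) (\<lambda>i z. D i (vconcat (fst z) (snd z)))"
proof -
  have "(\<lambda>(f, c). neg_log (D i (vconcat f c))) = (\<lambda>z. neg_log (D i (vconcat (fst z) (snd z))))" for i
    by (rule ext) (simp only: split_beta)
  then show ?thesis
    by (simp only: disc_objective_def sum_neg_log_def)
qed

lemma sets_joint[simp]: "sets (joint Q N i) = sets borel"
  by (simp add: joint_def)

lemma measurable_joint:
  assumes "is_network M S N" "i \<in> {1..M}"
  shows "(\<lambda>x. (shared N x, prediction N i x)) \<in> borel_measurable S"
proof -
  have [measurable]: "shared N \<in> borel_measurable S" "specific N i \<in> borel_measurable S"
    "classifier N \<in> borel_measurable borel"
    using assms by (auto simp: is_network_def)
  show ?thesis unfolding prediction_def by (intro borel_measurable_Pair) measurable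
qed

lemma prob_space_joint:
  assumes "is_network M S N" "i \<in> {1..M}" "prob_space (Q i)" "sets (Q i) = sets S"
  shows "prob_space (joint Q N i)"
  unfolding joint_def
proof (rule prob_space.prob_space_distr)
  show "(\<lambda>x. (shared N x, prediction N i x)) \<in> borel_measurable (Q i)"
    using measurable_joint[OF assms(1,2)] assms(4) by (simp cong: measurable_cong_sets)
qed fact

text \<open>Composition with \<open>vsplit\<close> turns the minimising posterior into a
  discriminator of the same value, and composition with \<open>vconcat\<close> turns each competitor
  into a function admissible in \<open>sum_neg_log_minimum\<close>.\<close>

lemma optimal_discriminator_exists:
  fixes N :: "('x, 's::finite, 'd::finite, 'l::finite) network"
  assumes M: "M \<ge> 1" and Q: "\<And>i. i \<in> {1..M} \<Longrightarrow> prob_space (Q i)"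
    "\<And>i. i \<in> {1..M} \<Longrightarrow> sets (Q i) = sets S" and N: "is_network M S N"
  obtains D where "optimal_discriminator M Q N D"
    "disc_objective M Q N D \<le> ennreal (real M * ln (real M))"
    "disc_objective M Q N D = ennreal (real M * ln (real M)) \<longleftrightarrow>
      (\<forall>i\<in>{1..M}. joint Q N i = mixture M (joint Q N))"
proof -
  let ?P = "joint Q N"
  have prob: "prob_space (?P i)" if "i \<in> {1..M}" for i
    using prob_space_joint[OF N that] Q that by auto
  obtain p :: "nat \<Rightarrow> (real ^ 's) \<times> (real ^ 'l) \<Rightarrow> real" where
    p: "\<And>i. i \<in> {1..M} \<Longrightarrow> p i \<in> borel_measurable borel"
      "\<And>i z. i \<in> {1..M} \<Longrightarrow> 0 \<le> p i z" "\<And>z. (\<Sum>i=1..M. p i z) = 1"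
    and minimal: "\<And>d. (\<And>i. i \<in> {1..M} \<Longrightarrow> d i \<in> borel_measurable borel) \<Longrightarrow>
      (\<And>i z. i \<in> {1..M} \<Longrightarrow> 0 \<le> d i z) \<Longrightarrow> (\<And>z. (\<Sum>i=1..M. d i z) = 1) \<Longrightarrow>
      sum_neg_log M ?P p \<le> sum_neg_log M ?P d"
    and bound: "sum_neg_log M ?P p \<le> ennreal (real M * ln (real M))"
    and eq: "sum_neg_log M ?P p = ennreal (real M * ln (real M)) \<longleftrightarrow>
      (\<forall>i\<in>{1..M}. ?P i = mixture M ?P)"
    using sum_neg_log_minimum[of M ?P, OF M sets_joint prob] by blast
  define D where "D i v = p i (vsplit v)" for i v
  have val: "disc_objective M Q N D = sum_neg_log M ?P p"
    by (simp add: disc_objective_eq D_def)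
  have "D i \<in> borel_measurable borel" if "i \<in> {1..M}" for i
    using p(1)[OF that] unfolding D_def by measurable
  then have "is_discriminator M D"
    unfolding is_discriminator_def using p by (auto simp: D_def)
  moreover have "disc_objective M Q N D \<le> disc_objective M Q N D'"
    if D': "is_discriminator M D'" for D'
    \<comment> \<open>The value of D is replaced first, so the second unfolding affects only the
      competitor.\<close>
    unfolding val unfolding disc_objective_eq
  proof (rule minimal)
    fix i assume "i \<in> {1..M}"
    with D' have [measurable]: "D' i \<in> borel_measurable borel"
      by (simp add: is_discriminator_def)
    show "(\<lambda>z. D' i (vconcat (fst z) (snd z))) \<in> borel_measurable borel"
      by (rule measurable_compose[OF borel_measurable_continuous_onI[OF continuous_vconcat]])
        measurable
  qed (use D' in \<open>auto simp: is_discriminator_def\<close>)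
  ultimately have "optimal_discriminator M Q N D"
    by (auto simp: optimal_discriminator_def is_arg_min_linorder)
  then show thesis
    using bound eq unfolding val[symmetric] by (rule that)
qed

section \<open>The value of the minimax game\<close>

text \<open>This carries the bound and the equality criterion from the one optimum constructed above
  to every optimum.\<close>

lemma optimal_discriminator_unique_value:
  assumes "optimal_discriminator M Q N D" "optimal_discriminator M Q N D'"
  shows "disc_objective M Q N D = disc_objective M Q N D'"
  using assms by (auto simp: optimal_discriminator_def is_arg_min_linorder intro: antisym)

lemma optimal_discriminator_INF:
  assumes "optimal_discriminator M Q N D"
  shows "(INF D'\<in>Collect (is_discriminator M). disc_objective M Q N D') = disc_objective M Q N D"
  using assms
  by (intro antisym INF_lower INF_greatest)
    (auto simp: optimal_discriminator_def is_arg_min_linorder)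

text \<open>A network that ignores its input makes the joint distributions agree whatever the
  domains are. The uniform output is a valid vector of label probabilities.\<close>

definition constant_network :: "('x, 's::finite, 'd::finite, 'l::finite) network"
  where "constant_network = \<lparr>shared = \<lambda>_. 0, specific = \<lambda>_ _. 0,
    classifier = \<lambda>_. \<chi> k. 1 / real CARD('l)\<rparr>"

lemma is_network_constant: "is_network M S constant_network"
  by (simp add: is_network_def constant_network_def)

lemma measure_eq_mixture:
  fixes P :: "nat \<Rightarrow> 'a::topological_space measure"
  assumes "M \<ge> 1" "\<And>i. i \<in> {1..M} \<Longrightarrow> P i = \<nu>" "sets \<nu> = sets borel" "i \<in> {1..M}"
  shows "P i = mixture M P"
proof (rule measure_eqI)
  fix A assume "A \<in> sets (P i)"
  with assms have "emeasure (mixture M P) A = (of_nat M * emeasure \<nu> A) / of_nat M"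
    by (subst emeasure_mixture) auto
  also have "\<dots> = emeasure \<nu> A"
    using assms(1) by (subst mult.commute) (simp add: mult_divide_eq_ennreal)
  finally show "emeasure (P i) A = emeasure (mixture M P) A"
    using assms by simp
qed (use assms in simp)

text \<open>The image of a probability measure under a constant map is a point mass, here the same
  one for every domain.\<close>

lemma joint_constant_network:
  defines "N \<equiv> constant_network :: ('x, 's::finite, 'd::finite, 'l::finite) network"
  assumes M: "M \<ge> 1" and Q: "\<And>i. i \<in> {1..M} \<Longrightarrow> prob_space (Q i)" and i: "i \<in> {1..M}"
  shows "joint Q N i = mixture M (joint Q N)"
proof -
  let ?z = "(0, \<chi> k. 1 / real CARD('l)) :: (real ^ 's) \<times> (real ^ 'l)"
  show ?thesis
  proof (rule measure_eq_mixture[where \<nu> = "return borel ?z"])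
    fix j assume j: "j \<in> {1..M}"
    interpret prob_space "Q j" using Q[OF j] .
    show "joint Q N j = return borel ?z"
      by (simp add: N_def joint_def prediction_def constant_network_def)
  qed (use M i in auto)
qed

text \<open>For a fixed network an optimal discriminator always exists, but its value may lie below
  M ln M. The optimum that requires equal distributions is therefore that of the game. The two
  existence claims keep the claims about optima from being vacuous.\<close>

theorem corollary1:
  fixes M :: nat and S :: "'x measure" and Q :: "nat \<Rightarrow> 'x measure"
  assumes "M \<ge> 1"
    and "\<And>i. i \<in> {1..M} \<Longrightarrow> prob_space (Q i)"
    and "\<And>i. i \<in> {1..M} \<Longrightarrow> sets (Q i) = sets S"
  shows "(\<forall>N :: ('x, 's::finite, 'd::finite, 'l::finite) network.
            is_network M S N \<longrightarrow> (\<exists>D. optimal_discriminator M Q N D)) \<and>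
         (\<exists>(N :: ('x, 's, 'd, 'l) network) D. minimax_optimum M S Q N D) \<and>
         (\<forall>(N :: ('x, 's, 'd, 'l) network) D. minimax_optimum M S Q N D \<longrightarrow>
            disc_objective M Q N D = ennreal (real M * ln (real M))) \<and>
         (\<forall>(N :: ('x, 's, 'd, 'l) network) D.
            is_network M S N \<and> optimal_discriminator M Q N D \<longrightarrow>
            disc_objective M Q N D \<le> ennreal (real M * ln (real M)) \<and>
            (disc_objective M Q N D = ennreal (real M * ln (real M)) \<longleftrightarrow>
               (\<forall>i\<in>{1..M}. joint Q N i = mixture M (joint Q N))) \<and>
            (minimax_optimum M S Q N D \<longleftrightarrow>
               (\<forall>i\<in>{1..M}. joint Q N i = mixture M (joint Q N))))"
proof -
  let ?c = "ennreal (real M * ln (real M))"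
  let ?obj = "disc_objective M Q :: ('x, 's, 'd, 'l) network \<Rightarrow> _"
  have ex: "\<exists>D. optimal_discriminator M Q N D" if "is_network M S N"
    for N :: "('x, 's, 'd, 'l) network"
    using optimal_discriminator_exists[of M Q S N, OF assms that] by blast
  have val: "?obj N D \<le> ?c"
    "?obj N D = ?c \<longleftrightarrow> (\<forall>i\<in>{1..M}. joint Q N i = mixture M (joint Q N))"
    if "is_network M S N" "optimal_discriminator M Q N D"
    for N :: "('x, 's, 'd, 'l) network" and D
    using optimal_discriminator_exists[of M Q S N, OF assms that(1)]
      optimal_discriminator_unique_value[OF that(2)] by metis+
  \<comment> \<open>V is the payoff that the networks maximise; any optimal discriminator evaluates
    it.\<close>
  define V where "V N = (INF D'\<in>Collect (is_discriminator M). ?obj N D')" for N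
  have V: "V N = ?obj N D" if "optimal_discriminator M Q N D" for N D
    unfolding V_def by (rule optimal_discriminator_INF[OF that])
  let ?N0 = "constant_network :: ('x, 's, 'd, 'l) network"
  have N0: "is_network M S ?N0" by (rule is_network_constant)
  obtain D0 where D0: "optimal_discriminator M Q ?N0 D0"
    using ex[OF N0] by blast
  have "\<forall>i\<in>{1..M}. joint Q ?N0 i = mixture M (joint Q ?N0)"
    using assms(1,2) by (blast intro: joint_constant_network)
  then have val_N0: "?obj ?N0 D0 = ?c"
    using val(2)[OF N0 D0] by blast
  have V_le: "V N \<le> ?c" if "is_network M S N" for N
    using ex[OF that] val(1)[OF that] V by metis
  have minimax: "minimax_optimum M S Q N D \<longleftrightarrow>
      is_network M S N \<and> optimal_discriminator M Q N D \<and> ?obj N D = ?c"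
    for N :: "('x, 's, 'd, 'l) network" and D
  proof -
    \<comment> \<open>The bound \<open>V_le\<close> is attained at \<open>?N0\<close>, so the
      maximum of V is exactly \<open>?c\<close>.\<close>
    have "is_arg_max V (is_network M S) N \<longleftrightarrow> is_network M S N \<and> V N = ?c"
    proof
      assume max: "is_arg_max V (is_network M S) N"
      then have "is_network M S N" "V ?N0 \<le> V N"
        using N0 by (auto simp: is_arg_max_linorder)
      then show "is_network M S N \<and> V N = ?c"
        using V[OF D0] val_N0 V_le by (auto intro: antisym)
    next
      assume "is_network M S N \<and> V N = ?c"
      then show "is_arg_max V (is_network M S) N"
        unfolding is_arg_max_linorder using V_le by simp
    qed
    then show ?thesis
      unfolding minimax_optimum_def V_def[symmetric] using V by auto
  qed
  show ?thesis
    using ex val minimax N0 D0 val_N0 by blast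
qed

end
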